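(* Let $R$ be a finite commutative ring. Then $\zeta_k(R)\le\zeta_{k+1}(R)$ for every integer $k\ge 2$. Consequently, the sequence $\{\zeta_k(R)\}_{k\ge 2}$ is monotonically increasing (in the non-strict sense).
   Context: For a finite commutative ring $R$, let $\mathcal I(R)$ denote the set of all ideals of $R$. For an integer $k\ge 2$, the ideal zero-product probability is $$\zeta_k(R)=\frac{|\{(I_1,\ldots,I_k)\in\mathcal I(R)^k : I_1I_2\cdots I_k=(0)\}|}{|\mathcal I(R)|^k},$$ where $I_1\cdots I_k$ is the usual product of ideals. *)

theory Defs
  imports Complex_Main "HOL-Algebra.Ideal_Product" "HOL-Algebra.FiniteProduct" "HOL-Library.FuncSet"
begin

text \<open>
  A \<open>k\<close>-tuple of ideals is an extensional function on \<open>{..<k}\<close>. The monoid \<^const>\<open>ideals_set\<close>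
  has the ideals of \<open>R\<close> as its carrier and \<^const>\<open>ideal_prod\<close> as multiplication, so that its
  \<^const>\<open>finprod\<close> over \<open>{..<k}\<close> is the product of the \<open>k\<close> ideals.
\<close>

definition ideal_zero_prod_tuples :: "('a, 'b) ring_scheme \<Rightarrow> nat \<Rightarrow> (nat \<Rightarrow> 'a set) set"
  where "ideal_zero_prod_tuples R k =
    {I \<in> {..<k} \<rightarrow>\<^sub>E {J. ideal J R}. (\<Otimes>\<^bsub>ideals_set R\<^esub>i\<in>{..<k}. I i) = {\<zero>\<^bsub>R\<^esub>}}"

definition ideal_zero_prod_prob :: "('a, 'b) ring_scheme \<Rightarrow> nat \<Rightarrow> real"
  where "ideal_zero_prod_prob R k =
    real (card (ideal_zero_prod_tuples R k)) / real (card {J. ideal J R}) ^ k"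

end

theory Submission
  imports Defs
begin

text \<open>
  If \<open>I\<^sub>1 \<cdots> I\<^sub>k = 0\<close> then \<open>I\<^sub>1 \<cdots> I\<^sub>k J = 0\<close> for every ideal \<open>J\<close>. Appending an ideal thus embeds
  the product of the zero-product \<open>k\<close>-tuples with the set of ideals into the zero-product
  \<open>(k+1)\<close>-tuples.
\<close>

lemma (in cring) ideal_zero_prod_tuples_extend:
  assumes I: "I \<in> ideal_zero_prod_tuples R k" and J: "ideal J R"
  shows "I(k := J) \<in> ideal_zero_prod_tuples R (Suc k)"
proof -
  interpret M: comm_monoid "ideals_set R" by (rule ideals_set_is_comm_monoid)
  have carr: "carrier (ideals_set R) = {J. ideal J R}" and mult: "mult (ideals_set R) = ideal_prod R"
    by (simp_all add: ideals_set_def)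
  have ideals: "ideal (I i) R" if "i < k" for i
    using I that by (auto simp: ideal_zero_prod_tuples_def)
  \<comment> \<open>The update at \<open>k\<close> is invisible here, because the indices run only
    over \<open>{..<k}\<close>.\<close>
  have "(\<Otimes>\<^bsub>ideals_set R\<^esub>i\<in>{..<k}. (I(k := J)) i) = (\<Otimes>\<^bsub>ideals_set R\<^esub>i\<in>{..<k}. I i)"
    using ideals by (intro M.finprod_cong') (auto simp: carr)
  also have "\<dots> = {\<zero>}"
    using I by (simp add: ideal_zero_prod_tuples_def)
  \<comment> \<open>Since \<open>{..<Suc k}\<close> is \<open>insert k {..<k}\<close>, the factor at
    the new index \<open>k\<close> splits off on the left.\<close>
  finally have "(\<Otimes>\<^bsub>ideals_set R\<^esub>i\<in>{..<Suc k}. (I(k := J)) i) = J \<cdot> {\<zero>}"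
    using ideals J by (simp add: lessThan_Suc carr mult Pi_def)
  also have "\<dots> = {\<zero>}"
    by (rule ideal_prod_zero[OF J])
  finally show ?thesis
    using I J by (simp add: ideal_zero_prod_tuples_def lessThan_Suc PiE_fun_upd del: fun_upd_apply)
qed

lemma (in ring) finite_ideals: "finite (carrier R) \<Longrightarrow> finite {J. ideal J R}"
  by (rule finite_subset[of _ "Pow (carrier R)"]) (auto dest: ideal.Icarr)

lemma (in cring) card_ideal_zero_prod_tuples_Suc:
  assumes "finite (carrier R)"
  shows "card (ideal_zero_prod_tuples R k) * card {J. ideal J R}
    \<le> card (ideal_zero_prod_tuples R (Suc k))"
proof -
  let ?T = "ideal_zero_prod_tuples R"
  have "inj_on (\<lambda>(I, J). I(k := J)) (?T k \<times> {J. ideal J R})"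
  proof (rule inj_onI, clarify)
    fix I J I' J'
    assume "I \<in> ?T k" "I' \<in> ?T k" and eq: "I(k := J) = I'(k := J')"
    \<comment> \<open>Tuples are extensional on \<open>{..<k}\<close>, so both take the value
      \<open>undefined\<close> at \<open>k\<close>. Resetting the updated function at
      \<open>k\<close> to this common value recovers the original tuple, and its value at
      \<open>k\<close> before the reset is the appended ideal.\<close>
    then have "I k = I' k"
      by (auto simp: ideal_zero_prod_tuples_def PiE_def extensional_def)
    with eq show "I = I' \<and> J = J'"
      by (metis fun_upd_eqD fun_upd_triv fun_upd_upd)
  qed
  \<comment> \<open>An injection bounds \<open>card\<close> only when the target is finite, as
    infinite sets have \<open>card\<close> 0.\<close>
  moreover have "finite (?T (Suc k))"
    using finite_ideals[OF assms]
    by (auto simp: ideal_zero_prod_tuples_def intro: finite_PiE finite_subset[OF Collect_restrict])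
  ultimately have "card (?T k \<times> {J. ideal J R}) \<le> card (?T (Suc k))"
    by (intro card_inj_on_le) (auto intro: ideal_zero_prod_tuples_extend)
  then show ?thesis
    by (simp add: card_cartesian_product)
qed

text \<open>This is the counting inequality divided by the number of all \<open>Suc k\<close>-tuples
  of ideals.\<close>

lemma (in cring) ideal_zero_prod_prob_Suc:
  assumes "finite (carrier R)"
  shows "ideal_zero_prod_prob R k \<le> ideal_zero_prod_prob R (Suc k)"
proof -
  let ?n = "card {J. ideal J R}"
  \<comment> \<open>The unit ideal \<open>carrier R\<close> is a witness.\<close>
  have "?n > 0"
    using finite_ideals[OF assms] oneideal by (auto simp: card_gt_0_iff)
  moreover have "real (card (ideal_zero_prod_tuples R k)) * real ?n
      \<le> real (card (ideal_zero_prod_tuples R (Suc k)))"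
    using card_ideal_zero_prod_tuples_Suc[OF assms]
    by (metis of_nat_le_iff of_nat_mult)
  ultimately show ?thesis
    by (simp add: ideal_zero_prod_prob_def field_simps)
qed

theorem theorem2p3:
  fixes R :: "('a, 'b) ring_scheme"
  assumes "cring R" and "finite (carrier R)"
  shows "(\<forall>k\<ge>2. ideal_zero_prod_prob R k \<le> ideal_zero_prod_prob R (k + 1))
    \<and> mono_on {2..} (ideal_zero_prod_prob R)"
proof -
  have step: "ideal_zero_prod_prob R k \<le> ideal_zero_prod_prob R (Suc k)" for k
    using cring.ideal_zero_prod_prob_Suc[OF assms] .
  then have "ideal_zero_prod_prob R i \<le> ideal_zero_prod_prob R j" if "i \<le> j" for i j
    using that by (rule lift_Suc_mono_le)
  with step show ?thesis
    by (auto intro: mono_onI)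
qed

end
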